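(* Let $D$ be a square-free integer, let $\mathbb{Z}[\sqrt{D}]$ denote the ring of integers of $\mathbb{Q}(\sqrt{D})$, and let $p$ be a prime integer which is irreducible but not prime in $\mathbb{Z}[\sqrt{D}]$. Let $z_0\in I_p(D)$ be a fundamental solution of the generalized Pell equation $x^2-y^2D=\lVert z_0\rVert$. If $z\in I_p(D)$ is in the same equivalence class as $z_0$, i.e. $z=z_0u$ for some unit $u$ of $\mathbb{Z}[\sqrt{D}]$ with $\lVert u\rVert=1$, then $A(p,z_0)\in \operatorname{ID}_2(\mathbb{Z}[\sqrt{D}])$ if and only if $A(p,z)\in\operatorname{ID}_2(\mathbb{Z}[\sqrt{D}])$. Furthermore, $A(p,z_0)$ has property (CZ) if and only if $A(p,z)$ has property (CZ).
   Context: Here $\mathbb{Z}[\sqrt{D}]=\{a+b\sqrt{D}:a,b\in\mathbb{Z}\}$ if $D\equiv 2,3 \pmod 4$ and $\mathbb{Z}[\sqrt{D}]=\{\frac{a+b\sqrt{D}}{2}:a,b\in\mathbb{Z},\ a\equiv b \pmod 2\}$ if $D\equiv 1\pmod 4$. $\bar z$ denotes the conjugate and $\lVert z\rVert=z\bar z$ the norm. $I_p(D)$ is the set of all non-unit $z\in\mathbb{Z}[\sqrt{D}]$ such that $z\notin\langle p\rangle$ but there exists $m\notin\langle p\rangle$ with $zm\in\langle p\rangle$ (for such $z$, $p$ divides $\lVert z\rVert$). For $z\in I_p(D)$, $A(p,z)=\begin{pmatrix} p & z\\ \bar z & \lVert z\rVert/p\end{pmatrix}$. For a ring $R$, $\operatorname{ID}_2(R)$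 is the set of $2\times 2$ matrices over $R$ that can be written as a product of (finitely many) idempotent matrices in $\mathbb{M}_2(R)$. A matrix $A(p,z)$ has property (CZ) if there exist $a,b,c\in\mathbb{Z}[\sqrt{D}]$ with $a(1-a)=bc$ such that $A(p,z)=\begin{pmatrix} a&b\\ c&1-a\end{pmatrix}\begin{pmatrix}\bar a&\bar c\\ \bar b&1-\bar a\end{pmatrix}$. *)

theory Defs
  imports "HOL-Analysis.Analysis" "HOL-Computational_Algebra.Squarefree"
    "HOL-Computational_Algebra.Primes"
begin

text \<open>We realise the ring Z[sqrt D] (ring of integers of Q(sqrt D)) as a subring of the
complex numbers, with a fixed choice of square root of D.\<close>

definition sqrtD :: "int \<Rightarrow> complex" where
  "sqrtD D = (if D \<ge> 0 then complex_of_real (sqrt (real_of_int D))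
              else \<i> * complex_of_real (sqrt (real_of_int (- D))))"

definition ZD :: "int \<Rightarrow> complex set" where
  "ZD D = (if D mod 4 = 1
           then {(of_int a + of_int b * sqrtD D) / 2 | a b :: int. a mod 2 = b mod 2}
           else {of_int a + of_int b * sqrtD D | a b :: int. True})"

text \<open>Coordinates: z = (a + b sqrt D)/2 with a, b integers.\<close>
definition coordD :: "int \<Rightarrow> complex \<Rightarrow> int \<times> int" where
  "coordD D z = (THE ab. z = (of_int (fst ab) + of_int (snd ab) * sqrtD D) / 2)"

text \<open>Conjugation a + b sqrt D \<mapsto> a - b sqrt D and the norm.\<close>
definition conjD :: "int \<Rightarrow> complex \<Rightarrow> complex" where
  "conjD D z = (of_int (fst (coordD D z)) - of_int (snd (coordD D z)) * sqrtD D) / 2"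

definition normD :: "int \<Rightarrow> complex \<Rightarrow> complex" where
  "normD D z = z * conjD D z"

definition dvdD :: "int \<Rightarrow> complex \<Rightarrow> complex \<Rightarrow> bool" where
  "dvdD D a b \<longleftrightarrow> (\<exists>c\<in>ZD D. b = a * c)"

definition unitD :: "int \<Rightarrow> complex \<Rightarrow> bool" where
  "unitD D u \<longleftrightarrow> u \<in> ZD D \<and> (\<exists>v\<in>ZD D. u * v = 1)"

definition irreducibleD :: "int \<Rightarrow> complex \<Rightarrow> bool" where
  "irreducibleD D p \<longleftrightarrow> p \<in> ZD D \<and> p \<noteq> 0 \<and> \<not> unitD D p \<and>
     (\<forall>x\<in>ZD D. \<forall>y\<in>ZD D. p = x * y \<longrightarrow> unitD D x \<or> unitD D y)"

definition primeD :: "int \<Rightarrow> complex \<Rightarrow> bool" where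
  "primeD D p \<longleftrightarrow> p \<in> ZD D \<and> p \<noteq> 0 \<and> \<not> unitD D p \<and>
     (\<forall>x\<in>ZD D. \<forall>y\<in>ZD D. dvdD D p (x * y) \<longrightarrow> dvdD D p x \<or> dvdD D p y)"

text \<open>The principal ideal generated by p.\<close>
definition idealD :: "int \<Rightarrow> complex \<Rightarrow> complex set" where
  "idealD D p = {p * w | w. w \<in> ZD D}"

definition Ip :: "int \<Rightarrow> int \<Rightarrow> complex set" where
  "Ip p D = {z \<in> ZD D. \<not> unitD D z \<and> z \<notin> idealD D (of_int p) \<and>
              (\<exists>m\<in>ZD D. m \<notin> idealD D (of_int p) \<and> z * m \<in> idealD D (of_int p))}"

definition Apz :: "int \<Rightarrow> int \<Rightarrow> complex \<Rightarrow> complex^2^2" where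
  "Apz D p z = vector [vector [of_int p, z], vector [conjD D z, normD D z / of_int p]]"

definition matD :: "int \<Rightarrow> complex^2^2 \<Rightarrow> bool" where
  "matD D M \<longleftrightarrow> (\<forall>i j. M $ i $ j \<in> ZD D)"

text \<open>Products of finitely many idempotent matrices over Z[sqrt D].\<close>
definition ID2 :: "int \<Rightarrow> (complex^2^2) set" where
  "ID2 D = {foldr (**) Es (mat 1) | Es. Es \<noteq> [] \<and>
              (\<forall>E\<in>set Es. matD D E \<and> E ** E = E)}"

definition propCZ :: "int \<Rightarrow> int \<Rightarrow> complex \<Rightarrow> bool" where
  "propCZ D p z \<longleftrightarrow> (\<exists>a\<in>ZD D. \<exists>b\<in>ZD D. \<exists>c\<in>ZD D. a * (1 - a) = b * c \<and>
     Apz D p z = (vector [vector [a, b], vector [c, 1 - a]] :: complex^2^2) **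
                 (vector [vector [conjD D a, conjD D c], vector [conjD D b, 1 - conjD D a]]
                   :: complex^2^2))"

text \<open>z and w lie in the same class of solutions of x^2 - y^2 D = N.\<close>
definition same_classD :: "int \<Rightarrow> complex \<Rightarrow> complex \<Rightarrow> bool" where
  "same_classD D z w \<longleftrightarrow> (\<exists>u. unitD D u \<and> normD D u = 1 \<and> w = z * u)"

text \<open>Fundamental solution of its class (Nagell): among the elements
(x + y sqrt D) of the class, y is the least nonnegative value; ties
(ambiguous classes) are broken by taking x maximal.  Coordinates are
stored doubled: x = a/2, y = b/2.\<close>
definition fundamental_solD :: "int \<Rightarrow> complex \<Rightarrow> bool" where
  "fundamental_solD D z0 \<longleftrightarrow> z0 \<in> ZD D \<and> snd (coordD D z0) \<ge> 0 \<and>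
     (\<forall>w. same_classD D z0 w \<longrightarrow> snd (coordD D z0) \<le> \<bar>snd (coordD D w)\<bar> \<and>
        (snd (coordD D w) = snd (coordD D z0) \<longrightarrow> fst (coordD D w) \<le> fst (coordD D z0)))"

end

theory Submission
  imports Defs
begin

text \<open>Multiplying z by a unit u of norm 1 conjugates A(p,z) by diagonal matrices:
with w the conjugate of u (so that u w = 1),
A(p, z u) = diag(1, w) A(p, z) diag(1, u).  Both diagonal matrices have entries in
Z[sqrt D] and are mutually inverse, so conjugating a factorisation of A(p, z) into
idempotents, or a (CZ) factorisation M M* with M = [[a, b], [c, 1 - a]], gives one of
A(p, z u); in the latter case the new factor is [[a, b u], [c w, 1 - a]].  The hypothesis
that p is not prime excludes D = 1, so that coordinates and conjugation in Z[sqrt D]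
are well defined; the other hypotheses on p, z0 and z are used only through
z0, z \<in> Z[sqrt D].\<close>

lemma sqrtD_square: "sqrtD D * sqrtD D = of_int D"
proof (cases "D \<ge> 0")
  case False
  have "(\<i> * x) * (\<i> * x) = - (x * x)" for x :: complex by (simp add: algebra_simps)
  with False show ?thesis by (simp add: sqrtD_def flip: of_real_mult)
qed (simp add: sqrtD_def flip: of_real_mult)

lemma squarefree_square_eq_imp_zero:
  fixes a b D :: int
  assumes "squarefree D" and "D \<noteq> 1" and eq: "b\<^sup>2 * D = a\<^sup>2"
  shows "b = 0"
proof (rule ccontr)
  assume "b \<noteq> 0"
  have "b\<^sup>2 dvd a\<^sup>2" using eq by (metis dvd_triv_left)
  then obtain k where "a = b * k" by fastforce
  with eq \<open>b \<noteq> 0\<close> have D: "D = k\<^sup>2" by (simp add: power_mult_distrib)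
  then have "k dvd 1" using squarefreeD[OF \<open>squarefree D\<close>] by simp
  then have "\<bar>k\<bar> = 1" by simp
  then have "k\<^sup>2 = 1" by (metis power2_abs power_one)
  with D \<open>D \<noteq> 1\<close> show False by simp
qed

lemma sqrtD_lin_indep:
  assumes "squarefree D" and "D \<noteq> 1" and eq: "of_int a + of_int b * sqrtD D = (0::complex)"
  shows "a = 0 \<and> b = 0"
proof -
  have "(of_int a :: complex)\<^sup>2 = (of_int b * sqrtD D)\<^sup>2"
    using eq by (simp add: add_eq_0_iff)
  then have "(of_int (a\<^sup>2) :: complex) = of_int (b\<^sup>2 * D)"
    by (simp add: power2_eq_square sqrtD_square mult_ac)
  then have "b = 0" using squarefree_square_eq_imp_zero assms(1,2) of_int_eq_iff by metis
  with eq show ?thesis by simp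
qed

definition ZD_parity :: "int \<Rightarrow> int \<Rightarrow> int \<Rightarrow> bool" where
  "ZD_parity D a b \<longleftrightarrow> (if D mod 4 = 1 then a mod 2 = b mod 2 else even a \<and> even b)"

lemma ZD_iff_half_coords:
  "z \<in> ZD D \<longleftrightarrow> (\<exists>a b. z = (of_int a + of_int b * sqrtD D) / 2 \<and> ZD_parity D a b)"
proof (cases "D mod 4 = 1")
  case True
  then show ?thesis by (auto simp: ZD_def ZD_parity_def)
next
  case False
  show ?thesis
  proof
    assume "z \<in> ZD D"
    then obtain a b where "z = of_int a + of_int b * sqrtD D"
      using False by (auto simp: ZD_def)
    then have "z = (of_int (2*a) + of_int (2*b) * sqrtD D) / 2 \<and> ZD_parity D (2*a) (2*b)"
      using False by (simp add: ZD_parity_def field_simps)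
    then show "\<exists>a b. z = (of_int a + of_int b * sqrtD D) / 2 \<and> ZD_parity D a b" by blast
  next
    assume "\<exists>a b. z = (of_int a + of_int b * sqrtD D) / 2 \<and> ZD_parity D a b"
    then obtain a b where "z = (of_int (2*a) + of_int (2*b) * sqrtD D) / 2"
      using False by (auto simp: ZD_parity_def elim!: evenE)
    then have "z = of_int a + of_int b * sqrtD D" by (simp add: add_divide_distrib)
    then show "z \<in> ZD D" using False by (auto simp: ZD_def)
  qed
qed

lemma coordD_eq:
  assumes "squarefree D" and "D \<noteq> 1" and z: "z = (of_int a + of_int b * sqrtD D) / 2"
  shows "coordD D z = (a, b)"
  unfolding coordD_def
proof (rule the_equality)
  fix ab :: "int \<times> int"
  assume "z = (of_int (fst ab) + of_int (snd ab) * sqrtD D) / 2"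
  with z have eq: "of_int a + of_int b * sqrtD D = of_int (fst ab) + of_int (snd ab) * sqrtD D"
    by (metis divide_cancel_right zero_neq_numeral)
  have "of_int (a - fst ab) + of_int (b - snd ab) * sqrtD D
      = (of_int a + of_int b * sqrtD D) - (of_int (fst ab) + of_int (snd ab) * sqrtD D)"
    by (simp add: algebra_simps)
  then have "of_int (a - fst ab) + of_int (b - snd ab) * sqrtD D = (0::complex)"
    by (simp only: eq diff_self)
  then show "ab = (a, b)"
    using sqrtD_lin_indep[OF assms(1,2)] by (cases ab) fastforce
qed (use z in simp)

lemma conjD_eq:
  assumes "squarefree D" and "D \<noteq> 1" and "z = (of_int a + of_int b * sqrtD D) / 2"
  shows "conjD D z = (of_int a - of_int b * sqrtD D) / 2"
  using coordD_eq[OF assms] by (simp add: conjD_def)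

lemma half_coords_mult:
  assumes A: "2 * A = a * c + b * d * D" and B: "2 * B = a * d + b * c"
  shows "(of_int a + of_int b * sqrtD D) / 2 * ((of_int c + of_int d * sqrtD D) / 2)
    = (of_int A + of_int B * sqrtD D) / (2::complex)"
proof -
  let ?s = "sqrtD D"
  have A': "2 * (of_int A :: complex) = of_int a * of_int c + of_int b * of_int d * of_int D"
    using arg_cong[OF A, of "of_int :: int \<Rightarrow> complex"] by simp
  have B': "2 * (of_int B :: complex) = of_int a * of_int d + of_int b * of_int c"
    using arg_cong[OF B, of "of_int :: int \<Rightarrow> complex"] by simp
  have "(of_int a + of_int b * ?s) / 2 * ((of_int c + of_int d * ?s) / 2)
      = ((of_int a * of_int c + of_int b * of_int d * (?s * ?s))
         + (of_int a * of_int d + of_int b * of_int c) * ?s) / 4"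
    by (simp add: field_simps)
  also have "\<dots> = (2 * of_int A + 2 * of_int B * ?s) / 4"
    by (simp only: A' B' sqrtD_square)
  finally show ?thesis by simp
qed

lemma ZD_parity_mult:
  assumes "ZD_parity D a b" and "ZD_parity D c d"
  shows "\<exists>A B. ZD_parity D A B \<and> 2 * A = a * c + b * d * D \<and> 2 * B = a * d + b * c"
proof (cases "D mod 4 = 1")
  case True
  then obtain k where k: "D = 4 * k + 1" by (metis mult.commute div_mult_mod_eq)
  from assms True have "a mod 2 = b mod 2" "c mod 2 = d mod 2" by (auto simp: ZD_parity_def)
  then obtain m n where mn: "a = b + 2 * m" "c = d + 2 * n"
    by (metis add.commute mod_eq_dvd_iff dvd_def diff_eq_eq mult.commute)
  define B where "B = b * d + m * d + b * n"
  define t where "t = m * n + k * b * d"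
  define A where "A = B + 2 * t"
  have "ZD_parity D A B" using True unfolding ZD_parity_def A_def by presburger
  moreover have "2 * A = a * c + b * d * D"
    unfolding A_def B_def t_def mn k by (simp add: algebra_simps)
  moreover have "2 * B = a * d + b * c" unfolding B_def mn by (simp add: algebra_simps)
  ultimately show ?thesis by blast
next
  case False
  with assms obtain a' b' c' d' where "a = 2 * a'" "b = 2 * b'" "c = 2 * c'" "d = 2 * d'"
    by (auto simp: ZD_parity_def elim!: evenE)
  with False show ?thesis
    by (intro exI[of _ "2 * (a' * c' + b' * d' * D)"] exI[of _ "2 * (a' * d' + b' * c')"])
      (simp add: ZD_parity_def algebra_simps)
qed

lemma ZD_mult: "x \<in> ZD D \<Longrightarrow> y \<in> ZD D \<Longrightarrow> x * y \<in> ZD D"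
  unfolding ZD_iff_half_coords by (metis ZD_parity_mult half_coords_mult)

lemma ZD_add: "x \<in> ZD D \<Longrightarrow> y \<in> ZD D \<Longrightarrow> x + y \<in> ZD D"
  unfolding ZD_iff_half_coords
proof (elim exE conjE)
  fix a b c d
  assume "x = (of_int a + of_int b * sqrtD D) / 2" "y = (of_int c + of_int d * sqrtD D) / 2"
    and "ZD_parity D a b" "ZD_parity D c d"
  then have "x + y = (of_int (a + c) + of_int (b + d) * sqrtD D) / 2 \<and> ZD_parity D (a + c) (b + d)"
    by (auto simp: ZD_parity_def field_simps) presburger+
  then show "\<exists>a b. x + y = (of_int a + of_int b * sqrtD D) / 2 \<and> ZD_parity D a b" by blast
qed

lemma ZD_0: "0 \<in> ZD D"
  unfolding ZD_iff_half_coords by (rule exI[of _ 0], rule exI[of _ 0]) (simp add: ZD_parity_def)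

lemma ZD_1: "1 \<in> ZD D"
  unfolding ZD_iff_half_coords by (rule exI[of _ 2], rule exI[of _ 0]) (simp add: ZD_parity_def)

lemma conjD_mult:
  assumes "squarefree D" and "D \<noteq> 1" and "x \<in> ZD D" and "y \<in> ZD D"
  shows "conjD D (x * y) = conjD D x * conjD D y"
proof -
  obtain a b c d where x: "x = (of_int a + of_int b * sqrtD D) / 2" and "ZD_parity D a b"
    and y: "y = (of_int c + of_int d * sqrtD D) / 2" and "ZD_parity D c d"
    using assms(3,4) unfolding ZD_iff_half_coords by blast
  then obtain A B where A: "2 * A = a * c + b * d * D" and B: "2 * B = a * d + b * c"
    using ZD_parity_mult by blast
  have "x * y = (of_int A + of_int B * sqrtD D) / 2"
    unfolding x y by (rule half_coords_mult[OF A B])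
  then have "conjD D (x * y) = (of_int A + of_int (- B) * sqrtD D) / 2"
    using conjD_eq[OF assms(1,2)] by simp
  also have "\<dots> = (of_int a + of_int (- b) * sqrtD D) / 2 * ((of_int c + of_int (- d) * sqrtD D) / 2)"
    by (rule half_coords_mult[symmetric]) (use A B in simp_all)
  also have "\<dots> = conjD D x * conjD D y"
    unfolding conjD_eq[OF assms(1,2) x] conjD_eq[OF assms(1,2) y] by simp
  finally show ?thesis .
qed

lemma
  assumes "squarefree D" and "D \<noteq> 1" and "x \<in> ZD D"
  shows ZD_conjD: "conjD D x \<in> ZD D" and conjD_conjD: "conjD D (conjD D x) = x"
proof -
  obtain a b where x: "x = (of_int a + of_int b * sqrtD D) / 2" and ab: "ZD_parity D a b"
    using assms(3) unfolding ZD_iff_half_coords by blast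
  have cx: "conjD D x = (of_int a + of_int (- b) * sqrtD D) / 2"
    using conjD_eq[OF assms(1,2) x] by simp
  have "ZD_parity D a (- b)" using ab by (auto simp: ZD_parity_def) presburger
  with cx show "conjD D x \<in> ZD D" unfolding ZD_iff_half_coords by blast
  show "conjD D (conjD D x) = x" by (subst conjD_eq[OF assms(1,2) cx]) (simp add: x)
qed

lemma ZD_1_eq_Ints: "ZD 1 = \<int>"
proof (intro equalityI subsetI)
  fix z assume "z \<in> ZD 1"
  then obtain a b where z: "z = (of_int a + of_int b) / 2" and "a mod 2 = b mod 2"
    by (auto simp: ZD_def sqrtD_def)
  then have "even (a + b)" by presburger
  then obtain n where "a + b = 2 * n" by (rule evenE)
  then have "z = of_int n"
    unfolding z by (metis nonzero_mult_div_cancel_left of_int_add of_int_mult of_int_numeral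
      zero_neq_numeral)
  then show "z \<in> \<int>" by simp
next
  fix z :: complex assume "z \<in> \<int>"
  then obtain n where "z = (of_int n + of_int n * sqrtD 1) / 2" by (auto simp: sqrtD_def elim!: Ints_cases)
  then show "z \<in> ZD 1" by (auto simp: ZD_def)
qed

lemma primeD_1_of_prime:
  assumes "prime (p::int)"
  shows "primeD 1 (of_int p)"
proof -
  have dvdD_of_dvd: "dvdD 1 (of_int p) (of_int j)" if "p dvd j" for j
  proof -
    from that obtain i where "j = p * i" by (rule dvdE)
    then show ?thesis unfolding dvdD_def ZD_1_eq_Ints by (auto intro!: bexI[of _ "of_int i"])
  qed
  have "\<not> unitD 1 (of_int p)"
  proof
    assume "unitD 1 (of_int p)"
    then obtain n where "of_int p * of_int n = (1::complex)"
      unfolding unitD_def ZD_1_eq_Ints by (blast elim: Ints_cases)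
    then have "p * n = 1" by (metis of_int_1 of_int_eq_iff of_int_mult)
    then show False using assms by (metis dvdI not_prime_unit)
  qed
  moreover have "dvdD 1 (of_int p) x \<or> dvdD 1 (of_int p) y"
    if x_in: "x \<in> ZD 1" and y_in: "y \<in> ZD 1" and dvd: "dvdD 1 (of_int p) (x * y)" for x y
  proof -
    obtain m where x: "x = of_int m" using x_in unfolding ZD_1_eq_Ints by (blast elim: Ints_cases)
    obtain n where y: "y = of_int n" using y_in unfolding ZD_1_eq_Ints by (blast elim: Ints_cases)
    obtain c where "c \<in> \<int>" and "x * y = of_int p * c"
      using dvd unfolding dvdD_def ZD_1_eq_Ints by blast
    then obtain k where "of_int (m * n) = (of_int (p * k) :: complex)"
      unfolding x y by (auto elim: Ints_cases)
    then have "p dvd m * n" unfolding of_int_eq_iff by simp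
    then have "p dvd m \<or> p dvd n" using assms prime_dvd_mult_iff by blast
    then show ?thesis unfolding x y using dvdD_of_dvd by blast
  qed
  moreover have "(of_int p :: complex) \<noteq> 0" using assms by simp
  ultimately show ?thesis unfolding primeD_def ZD_1_eq_Ints by simp
qed

lemma mat2_mult:
  "(vector [vector [a, b], vector [c, d]] :: 'a::comm_ring_1^2^2)
     ** (vector [vector [e, f], vector [g, h]] :: 'a^2^2)
   = vector [vector [a*e + b*g, a*f + b*h], vector [c*e + d*g, c*f + d*h]]"
  by (simp add: matrix_matrix_mult_def vec_eq_iff forall_2 sum_2)

lemma mat2_eq_iff:
  "(vector [vector [a, b], vector [c, d]] :: 'a::zero^2^2) = vector [vector [e, f], vector [g, h]]
   \<longleftrightarrow> a = e \<and> b = f \<and> c = g \<and> d = h"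
  by (auto simp add: vec_eq_iff forall_2)

definition diag2 :: "'a::zero \<Rightarrow> 'a \<Rightarrow> 'a^2^2" where
  "diag2 x y = vector [vector [x, 0], vector [0, y]]"

lemma diag2_mult_eq_mat1:
  "u * w = 1 \<Longrightarrow> diag2 1 u ** diag2 1 w = (mat 1 :: 'a::comm_ring_1^2^2)"
  by (simp add: diag2_def mat2_mult vec_eq_iff forall_2 mat_def)

lemma diag2_conj_mat2:
  "diag2 1 w ** vector [vector [a, b], vector [c, d]] ** diag2 1 u
   = (vector [vector [a, b * u], vector [w * c, w * d * u]] :: 'a::comm_ring_1^2^2)"
  by (simp add: diag2_def mat2_mult)

lemma matrix_mul_conj_distrib:
  fixes A B U V :: "'a::semiring_1^'n^'n"
  assumes "U ** V = mat 1"
  shows "V ** (A ** B) ** U = (V ** A ** U) ** (V ** B ** U)"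
proof -
  have "(V ** A ** U) ** (V ** B ** U) = V ** A ** (U ** V) ** B ** U"
    by (simp only: matrix_mul_assoc)
  then show ?thesis using assms by (simp add: matrix_mul_assoc)
qed

lemma foldr_matrix_mul_conj:
  fixes U V :: "'a::semiring_1^'n^'n"
  assumes "U ** V = mat 1" and "V ** U = mat 1"
  shows "foldr (**) (map (\<lambda>E. V ** E ** U) Es) (mat 1) = V ** foldr (**) Es (mat 1) ** U"
proof (induction Es)
  case (Cons E Es)
  then show ?case by (simp add: matrix_mul_conj_distrib[OF assms(1)])
qed (simp add: assms(2))

lemma matD_mult: "matD D A \<Longrightarrow> matD D B \<Longrightarrow> matD D (A ** B)"
  by (simp add: matD_def matrix_matrix_mult_def sum_2 ZD_add ZD_mult)

lemma matD_diag2: "x \<in> ZD D \<Longrightarrow> y \<in> ZD D \<Longrightarrow> matD D (diag2 x y)"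
  by (simp add: matD_def diag2_def forall_2 ZD_0)

lemma ID2_conj_closed:
  assumes "matD D P" and "matD D Q" and "P ** Q = mat 1" and "Q ** P = mat 1"
    and "A \<in> ID2 D"
  shows "Q ** A ** P \<in> ID2 D"
proof -
  obtain Es where A: "A = foldr (**) Es (mat 1)" and "Es \<noteq> []"
    and Es: "\<forall>E\<in>set Es. matD D E \<and> E ** E = E"
    using assms(5) unfolding ID2_def by blast
  have "Q ** A ** P = foldr (**) (map (\<lambda>E. Q ** E ** P) Es) (mat 1)"
    unfolding A foldr_matrix_mul_conj[OF assms(3,4)] ..
  moreover have "matD D (Q ** E ** P) \<and> (Q ** E ** P) ** (Q ** E ** P) = Q ** E ** P"
    if "E \<in> set Es" for E
    using that Es assms(1,2) matD_mult matrix_mul_conj_distrib[OF assms(3), symmetric] by metis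
  ultimately show ?thesis
    using \<open>Es \<noteq> []\<close> unfolding ID2_def by (auto intro!: exI[of _ "map (\<lambda>E. Q ** E ** P) Es"])
qed

lemma Apz_mult_unit:
  assumes "squarefree D" and "D \<noteq> 1" and "z \<in> ZD D" and "u \<in> ZD D"
    and uw: "u * conjD D u = 1"
  shows "Apz D p (z * u) = diag2 1 (conjD D u) ** Apz D p z ** diag2 1 u"
proof -
  have cancel: "conjD D u * x * u = x" for x using uw by (simp add: mult_ac)
  have cz: "conjD D (z * u) = conjD D u * conjD D z"
    using conjD_mult[OF assms(1-4)] by (simp add: mult.commute)
  have "normD D (z * u) = normD D z * (u * conjD D u)"
    unfolding normD_def cz by (simp add: mult_ac)
  then have nz: "normD D (z * u) = normD D z" using uw by simp
  show ?thesis
    unfolding Apz_def diag2_conj_mat2 mat2_eq_iff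
    by (simp add: cz nz cancel del: times_divide_eq_right)
qed

lemma ID2_Apz_mult_unit:
  assumes "squarefree D" and "D \<noteq> 1" and "z \<in> ZD D" and "u \<in> ZD D"
    and uw: "u * conjD D u = 1" and "Apz D p z \<in> ID2 D"
  shows "Apz D p (z * u) \<in> ID2 D"
proof -
  let ?w = "conjD D u"
  have w: "?w \<in> ZD D" by (rule ZD_conjD[OF assms(1,2,4)])
  have inv: "diag2 1 u ** diag2 1 ?w = mat 1" using uw by (rule diag2_mult_eq_mat1)
  have inv': "diag2 1 ?w ** diag2 1 u = mat 1" using uw by (simp add: diag2_mult_eq_mat1 mult.commute)
  show ?thesis
    unfolding Apz_mult_unit[OF assms(1-5)]
    by (rule ID2_conj_closed[OF matD_diag2[OF ZD_1 assms(4)] matD_diag2[OF ZD_1 w] inv inv' assms(6)])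
qed

lemma propCZ_mult_unit:
  assumes "squarefree D" and "D \<noteq> 1" and "z \<in> ZD D" and "u \<in> ZD D"
    and uw: "u * conjD D u = 1" and "propCZ D p z"
  shows "propCZ D p (z * u)"
proof -
  let ?w = "conjD D u"
  obtain a b c where a: "a \<in> ZD D" and b: "b \<in> ZD D" and c: "c \<in> ZD D"
    and rel: "a * (1 - a) = b * c"
    and fac: "Apz D p z = (vector [vector [a, b], vector [c, 1 - a]] :: complex^2^2) **
      vector [vector [conjD D a, conjD D c], vector [conjD D b, 1 - conjD D a]]"
    using assms(6) unfolding propCZ_def by blast
  have w: "?w \<in> ZD D" and ww: "conjD D ?w = u"
    by (rule ZD_conjD[OF assms(1,2,4)], rule conjD_conjD[OF assms(1,2,4)])
  have cancel: "?w * x * u = x" for x using uw by (simp add: mult_ac)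
  have inv: "diag2 1 u ** diag2 1 ?w = mat 1" using uw by (rule diag2_mult_eq_mat1)
  have cb: "conjD D (b * u) = ?w * conjD D b"
    using conjD_mult[OF assms(1,2) b assms(4)] by (simp add: mult.commute)
  have cc: "conjD D (?w * c) = conjD D c * u"
    using conjD_mult[OF assms(1,2) w c] ww by (simp add: mult.commute)
  have "Apz D p (z * u) = diag2 1 ?w ** ((vector [vector [a, b], vector [c, 1 - a]] :: complex^2^2) **
      vector [vector [conjD D a, conjD D c], vector [conjD D b, 1 - conjD D a]]) ** diag2 1 u"
    unfolding Apz_mult_unit[OF assms(1-5)] fac ..
  also have "\<dots> = (diag2 1 ?w ** (vector [vector [a, b], vector [c, 1 - a]] :: complex^2^2) ** diag2 1 u) **
      (diag2 1 ?w ** vector [vector [conjD D a, conjD D c], vector [conjD D b, 1 - conjD D a]]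
        ** diag2 1 u)"
    by (rule matrix_mul_conj_distrib[OF inv])
  also have "\<dots> = (vector [vector [a, b * u], vector [?w * c, 1 - a]] :: complex^2^2) **
      vector [vector [conjD D a, conjD D (?w * c)], vector [conjD D (b * u), 1 - conjD D a]]"
    unfolding diag2_conj_mat2 cancel cb cc ..
  finally have "Apz D p (z * u) = \<dots>" .
  moreover have "a * (1 - a) = (b * u) * (?w * c)"
    using rel uw by (simp add: mult_ac)
  ultimately show ?thesis
    unfolding propCZ_def
    by (intro bexI[of _ a] bexI[of _ "b * u"] bexI[of _ "?w * c"] conjI a ZD_mult b c w assms(4))
qed

theorem proposition2p4:
  fixes D p :: int and z0 z u :: complex
  assumes "squarefree D"
    and "prime p"
    and "irreducibleD D (of_int p)" and "\<not> primeD D (of_int p)"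
    and "z0 \<in> Ip p D" and "fundamental_solD D z0"
    and "z \<in> Ip p D"
    and "unitD D u" and "normD D u = 1" and "z = z0 * u"
  shows "(Apz D p z0 \<in> ID2 D \<longleftrightarrow> Apz D p z \<in> ID2 D) \<and> (propCZ D p z0 \<longleftrightarrow> propCZ D p z)"
proof -
  let ?w = "conjD D u"
  have D1: "D \<noteq> 1" using assms(2,4) primeD_1_of_prime by blast
  have z0: "z0 \<in> ZD D" and z: "z \<in> ZD D" using assms(5,7) by (simp_all add: Ip_def)
  have u: "u \<in> ZD D" and uw: "u * ?w = 1"
    using assms(8,9) by (simp_all add: unitD_def normD_def)
  have w: "?w \<in> ZD D" and ww: "?w * conjD D ?w = 1"
    using ZD_conjD[OF assms(1) D1 u] conjD_conjD[OF assms(1) D1 u] uw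
    by (simp_all add: mult.commute)
  have z0_eq: "z * ?w = z0" using assms(10) uw by (simp add: mult.assoc)
  show ?thesis
    using ID2_Apz_mult_unit[OF assms(1) D1 z0 u uw, folded assms(10)]
      ID2_Apz_mult_unit[OF assms(1) D1 z w ww, unfolded z0_eq]
      propCZ_mult_unit[OF assms(1) D1 z0 u uw, folded assms(10)]
      propCZ_mult_unit[OF assms(1) D1 z w ww, unfolded z0_eq]
    by blast
qed

end
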